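(* Let $l,D_{ax},v,k,n,T>0$ and $\alpha\in[0,\tfrac12]$, and let $\overline{C}_A$ be the steady-state solution defined in the context. Let $w$ be a solution of the problem $$\frac{\partial w}{\partial t}=D_{ax}\frac{\partial^2 w}{\partial x^2}-v\frac{\partial w}{\partial x}+k\,\overline{C}_A^{\,n}-k\,(w+\overline{C}_A)^n,\qquad (x,t)\in(0,l)\times(0,T),$$ $$w(0,t)=u_w(t)+\frac{D_{ax}}{v}\frac{\partial w}{\partial x}\Big|_{x=0},\qquad \frac{\partial w}{\partial x}\Big|_{x=l}=0,$$ with the boundary feedback control $u_w(t)=\alpha\,w(0,t)$. Then $$\|w(\cdot,t)\|_{L^2_\rho(0,l)}\leqslant e^{-\frac{v^2}{16D_{ax}}t}\,\|w(\cdot,0)\|_{L^2_\rho(0,l)},\qquad t\in[0,T].$$ Consequently, if $\lambda$ denotes the exponential decay rate of the solutions, then $$\lambda\geqslant\lambda_T:=\frac{v^2}{16D_{ax}}.$$ This estimate is global, and the bound $\lambda_T$ does not account for the dependence of the decay rate of a particular solution on the reaction order $n$, the rate constant $k$, and the control gain $\alpha$.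
   Context: All functions are real-valued. The constants are: $l>0$ (reactor length), $D_{ax}>0$ (axial dispersion coefficient), $v>0$ (flow rate), $k>0$ (reaction rate constant), $n>0$ (reaction order), $\alpha\in[0,\tfrac12]$ (feedback gain). Steady state: $\overline{C}_A\in C^2[0,l]$ is a solution of $$D_{ax}\overline{C}_A''=v\,\overline{C}_A'+k\,\overline{C}_A^{\,n}\ \text{ on }(0,l),\qquad \overline{C}_A(0)=\overline{u}+\tfrac{D_{ax}}{v}\overline{C}_A'(0),\qquad \overline{C}_A'(l)=0,$$ where $\overline{u}>0$ is a constant selected so that $\overline{C}_A(x)\geqslant 0$ for all $x\in[0,l]$. The function $w$ is the deviation $w(x,t)=C_A(x,t)-\overline{C}_A(x)$ of a reactant concentration $C_A$ from the steady state. Standing assumption: only nonnegative concentrations are considered, i.e. $w+\overline{C}_A=C_A\geqslant 0$ for almost all $(x,t)\in(0,l)\times(0,T)$. Weighted space: the weight is $\rho(x)=\rho_0e^{-\gamma x}$, $x\in[0,l]$, with $\rho_0>0$ a constant and $\gamma=\frac{v}{2D_{ax}}$ (i.e. $\rho'=-\gamma\rho$, $\rho(0)=\rho_0$), and $\|f\|_{L^2_\rho(0,l)}=\left(\int_0^l\rho(x)f(x)^2\,dx\right)^{1/2}$. Exponential decay rate: for a solution $w$ defined for all $t\geqslant 0$ with $w(\cdot,0)\neq 0$, it is $-\limsup_{t\to\infty}\frac1t\log\frac{\|w(\cdot,t)\|_{L^2_\rho(0,l)}}{\|w(\cdot,0)\|_{L^2_\rho(0,l)}}$. The subscript in $\lambda_T$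 stands for "theoretical" and does not refer to the time horizon $T$. *)

theory Defs
  imports "HOL-Analysis.Analysis"
begin

definition steady_state ::
  "real \<Rightarrow> real \<Rightarrow> real \<Rightarrow> real \<Rightarrow> real \<Rightarrow> real \<Rightarrow> (real \<Rightarrow> real) \<Rightarrow> bool"
where
  "steady_state Dax v k n l ubar C \<longleftrightarrow>
     (\<exists>C' C''.
        (\<forall>x\<in>{0..l}. (C has_real_derivative C' x) (at x within {0..l})) \<and>
        (\<forall>x\<in>{0..l}. (C' has_real_derivative C'' x) (at x within {0..l})) \<and>
        continuous_on {0..l} C'' \<and>
        (\<forall>x\<in>{0<..<l}. Dax * C'' x = v * C' x + k * C x powr n) \<and>
        C 0 = ubar + Dax / v * C' 0 \<and>
        C' l = 0)"

definition in_L2 :: "real \<Rightarrow> (real \<Rightarrow> real) \<Rightarrow> bool" where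
  "in_L2 l f \<longleftrightarrow>
     f \<in> borel_measurable (lebesgue_on {0<..<l}) \<and>
     integrable (lebesgue_on {0<..<l}) (\<lambda>x. (f x)\<^sup>2)"

(* Solutions are classical for 0 < t < T: the derivatives in the equation are continuous in the
   open rectangle, and w and w_x are continuous up to x = 0 and x = l, where w_x is one-sided.
   The values at t = 0 and t = T are attained only in L2(0,l), so that the initial state may be
   any element of L2(0,l). *)
definition deviation_solution ::
  "real \<Rightarrow> real \<Rightarrow> real \<Rightarrow> real \<Rightarrow> real \<Rightarrow> real \<Rightarrow> (real \<Rightarrow> real) \<Rightarrow> (real \<Rightarrow> real) \<Rightarrow>
   (real \<Rightarrow> real \<Rightarrow> real) \<Rightarrow> bool"
where
  "deviation_solution Dax v k n l T C u w \<longleftrightarrow>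
     (\<forall>t\<in>{0..T}. in_L2 l (\<lambda>x. w x t)) \<and>
     (\<forall>t\<in>{0..T}.
        ((\<lambda>s. \<integral>x. (w x s - w x t)\<^sup>2 \<partial>lebesgue_on {0<..<l}) \<longlongrightarrow> 0) (at t within {0..T})) \<and>
     (\<exists>wt wx wxx.
        (\<forall>x\<in>{0..l}. \<forall>t\<in>{0<..<T}.
           ((\<lambda>y. w y t) has_real_derivative wx x t) (at x within {0..l})) \<and>
        (\<forall>x\<in>{0<..<l}. \<forall>t\<in>{0<..<T}.
           ((\<lambda>y. wx y t) has_real_derivative wxx x t) (at x) \<and>
           ((\<lambda>s. w x s) has_real_derivative wt x t) (at t)) \<and>
        continuous_on ({0..l} \<times> {0<..<T}) (\<lambda>(x, t). w x t) \<and>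
        continuous_on ({0..l} \<times> {0<..<T}) (\<lambda>(x, t). wx x t) \<and>
        continuous_on ({0<..<l} \<times> {0<..<T}) (\<lambda>(x, t). wxx x t) \<and>
        continuous_on ({0<..<l} \<times> {0<..<T}) (\<lambda>(x, t). wt x t) \<and>
        (\<forall>x\<in>{0<..<l}. \<forall>t\<in>{0<..<T}.
           wt x t = Dax * wxx x t - v * wx x t + k * C x powr n - k * (w x t + C x) powr n) \<and>
        (\<forall>t\<in>{0<..<T}. w 0 t = u t + Dax / v * wx 0 t \<and> wx l t = 0))"

definition nonneg_concentration ::
  "real \<Rightarrow> real \<Rightarrow> (real \<Rightarrow> real) \<Rightarrow> (real \<Rightarrow> real \<Rightarrow> real) \<Rightarrow> bool"
where
  "nonneg_concentration l T C w \<longleftrightarrow>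
     (AE (x, t) in lebesgue_on ({0<..<l} \<times> {0<..<T}). 0 \<le> w x t + C x)"

definition weight :: "real \<Rightarrow> real \<Rightarrow> real \<Rightarrow> real \<Rightarrow> real" where
  "weight rho0 v Dax x = rho0 * exp (- (v / (2 * Dax)) * x)"

definition weighted_norm :: "(real \<Rightarrow> real) \<Rightarrow> real \<Rightarrow> (real \<Rightarrow> real) \<Rightarrow> real" where
  "weighted_norm \<rho> l f = sqrt (\<integral>x. \<rho> x * (f x)\<^sup>2 \<partial>lebesgue_on {0<..<l})"

(* A solution may vanish identically from some time on, hence log 0 = -infinity. *)
definition ext_log :: "real \<Rightarrow> ereal" where
  "ext_log r = (if r > 0 then ereal (ln r) else - \<infinity>)"

definition decay_rate :: "(real \<Rightarrow> real) \<Rightarrow> real \<Rightarrow> (real \<Rightarrow> real \<Rightarrow> real) \<Rightarrow> ereal" where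
  "decay_rate \<rho> l w =
     - Limsup at_top (\<lambda>t. ereal (1 / t) *
         ext_log (weighted_norm \<rho> l (\<lambda>x. w x t) / weighted_norm \<rho> l (\<lambda>x. w x 0)))"

definition lambda_T :: "real \<Rightarrow> real \<Rightarrow> real" where
  "lambda_T v Dax = v\<^sup>2 / (16 * Dax)"

end

theory Submission
  imports Defs
begin

text \<open>
The theorem is an energy estimate for \<open>E(t) = \<integral> \<rho> w\<^sup>2\<close>. The weight is tuned to the transport term: since
\<open>\<rho>' = - (v / (2 Dax)) \<rho>\<close>, integration by parts turns diffusion and convection together into a boundary
flux, a dissipation \<open>- 2 Dax \<integral> \<rho> w\<^sub>x\<^sup>2\<close> and the damping \<open>- (v\<^sup>2 / (4 Dax)) E\<close>. In pointwise form, with the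
flux \<open>B = 2 \<rho> (Dax w w\<^sub>x - (v / 4) w\<^sup>2)\<close>,
  \<open>(\<rho> w\<^sup>2)\<^sub>t = B\<^sub>x - (v\<^sup>2 / (4 Dax)) \<rho> w\<^sup>2 - 2 Dax \<rho> w\<^sub>x\<^sup>2 - 2 k \<rho> w ((w + C)\<^sup>n - C\<^sup>n)\<close>.
The reaction term has a sign because \<open>y \<mapsto> y\<^sup>n\<close> is increasing on the nonnegative numbers
(\<open>reaction_dissipative\<close>). The flux difference \<open>B(l) - B(0)\<close> has a sign because \<open>w\<^sub>x(l) = 0\<close> makes
\<open>B(l) \<le> 0\<close>, and because the feedback law gives \<open>Dax w\<^sub>x(0) = (1 - \<alpha>) v w(0)\<close> and hence
\<open>B(0) = 2 \<rho>(0) v (3/4 - \<alpha>) w(0)\<^sup>2 \<ge> 0\<close>. So the energy decays at the rate \<open>v\<^sup>2 / (4 Dax)\<close>, the norm at the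
rate \<open>v\<^sup>2 / (8 Dax)\<close>, which exceeds the rate \<open>v\<^sup>2 / (16 Dax)\<close> of the theorem.

The remaining work is regularity. The time derivative and the second space derivative are continuous
only inside the rectangle, so \<open>E\<close> cannot be differentiated directly. The estimate is made on
\<open>[d, l - d]\<close> instead, and \<open>d \<rightarrow> 0\<close> costs only a small flux error, as \<open>B\<close> is uniformly continuous up to
\<open>x = 0\<close> and \<open>x = l\<close> on compact time intervals (\<open>energy_decay_from_local_balance\<close>). The times \<open>0\<close> and \<open>T\<close>
are then reached because the energy is continuous along \<open>L\<^sup>2\<close>-convergence
(\<open>weighted_square_integral_tendsto\<close>). Finally, a concentration that is nonnegative almost everywhere
and continuous is nonnegative at every interior point (\<open>AE_nonneg_imp_nonneg_on_open\<close>).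
\<close>

section \<open>Energy decay from a local balance law\<close>

text \<open>Integrating the balance law over \<open>[a, b]\<close> bounds the derivative of the energy by the net flux minus
\<open>r\<close> times the energy; Gronwall's integrating factor \<open>exp (r \<tau>)\<close> does the rest. The tolerance \<open>\<epsilon>\<close> is there
because the flux has a sign only at the ends of the full interval.\<close>

lemma energy_bound_on_subinterval:
  fixes e et B Bx :: "real \<Rightarrow> real \<Rightarrow> real"
  assumes ab: "a \<le> b" and st: "0 < s" "s \<le> t" "t < T" and pos: "0 \<le> r" "0 \<le> \<epsilon>"
    and cont_e: "\<And>\<tau>. \<tau> \<in> {0<..<T} \<Longrightarrow> continuous_on {a..b} (\<lambda>x. e x \<tau>)"
    and deriv_e: "\<And>x \<tau>. x \<in> {a..b} \<Longrightarrow> \<tau> \<in> {0<..<T} \<Longrightarrow>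
      ((\<lambda>\<sigma>. e x \<sigma>) has_real_derivative et x \<tau>) (at \<tau>)"
    and cont_et: "continuous_on ({a..b} \<times> {0<..<T}) (\<lambda>(x, \<tau>). et x \<tau>)"
    and deriv_B: "\<And>x \<tau>. x \<in> {a..b} \<Longrightarrow> \<tau> \<in> {0<..<T} \<Longrightarrow>
      ((\<lambda>y. B y \<tau>) has_real_derivative Bx x \<tau>) (at x within {a..b})"
    and balance: "\<And>x \<tau>. x \<in> {a..b} \<Longrightarrow> \<tau> \<in> {0<..<T} \<Longrightarrow> et x \<tau> \<le> Bx x \<tau> - r * e x \<tau>"
    and flux: "\<And>\<tau>. \<tau> \<in> {s..t} \<Longrightarrow> B b \<tau> - B a \<tau> \<le> \<epsilon>"
  shows "exp (r * t) * integral {a..b} (\<lambda>x. e x t)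
    \<le> exp (r * s) * integral {a..b} (\<lambda>x. e x s) + \<epsilon> * exp (r * t) * (t - s)"
proof -
  define I where "I \<tau> = integral {a..b} (\<lambda>x. e x \<tau>)" for \<tau>
  define I' where "I' \<tau> = integral {a..b} (\<lambda>x. et x \<tau>)" for \<tau>
  have I_deriv: "(I has_real_derivative I' \<tau>) (at \<tau>)" if \<tau>: "\<tau> \<in> {0<..<T}" for \<tau>
  proof -
    have cont': "continuous_on ({0<..<T} \<times> {a..b}) (\<lambda>(\<tau>, x). et x \<tau>)"
      using cont_et by (rule continuous_on_swap_args)
    have "((\<lambda>\<tau>. integral (cbox a b) (\<lambda>x. e x \<tau>)) has_field_derivative
        integral (cbox a b) (\<lambda>x. et x \<tau>)) (at \<tau> within {0<..<T})"
    proof (rule leibniz_rule_field_derivative)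
      show "((\<lambda>\<sigma>. e x \<sigma>) has_field_derivative et x \<sigma>) (at \<sigma> within {0<..<T})"
        if "\<sigma> \<in> {0<..<T}" "x \<in> cbox a b" for \<sigma> x
        using deriv_e[of x \<sigma>] that by (simp add: has_field_derivative_at_within)
      show "(\<lambda>x. e x \<sigma>) integrable_on cbox a b" if "\<sigma> \<in> {0<..<T}" for \<sigma>
        using cont_e[OF that] by (simp add: integrable_continuous_real)
    qed (use \<tau> cont' in auto)
    then show ?thesis
      using \<tau> unfolding I_def I'_def by (simp add: at_within_open[of \<tau> "{0<..<T}"])
  qed
  have I'_le: "I' \<tau> \<le> \<epsilon> - r * I \<tau>" if \<tau>: "\<tau> \<in> {s..t}" for \<tau>
  proof -
    have \<tau>': "\<tau> \<in> {0<..<T}" using \<tau> st by auto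
    have ftc: "((\<lambda>x. Bx x \<tau>) has_integral B b \<tau> - B a \<tau>) {a..b}"
      using ab deriv_B \<tau>'
      by (intro fundamental_theorem_of_calculus)
        (auto simp: has_real_derivative_iff_has_vector_derivative[symmetric])
    have e_int: "((\<lambda>x. e x \<tau>) has_integral I \<tau>) {a..b}"
      unfolding I_def using cont_e[OF \<tau>'] by (simp add: integrable_continuous_real integrable_integral)
    have "continuous_on {a..b} ((\<lambda>(x, \<tau>). et x \<tau>) \<circ> (\<lambda>x. (x, \<tau>)))"
      using \<tau>' by (intro continuous_on_compose continuous_intros continuous_on_subset[OF cont_et]) auto
    then have "continuous_on {a..b} (\<lambda>x. et x \<tau>)" by (simp add: comp_def)
    then have et_int: "((\<lambda>x. et x \<tau>) has_integral I' \<tau>) {a..b}"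
      unfolding I'_def by (simp add: integrable_continuous_real integrable_integral)
    have "I' \<tau> \<le> (B b \<tau> - B a \<tau>) - r * I \<tau>"
      by (rule has_integral_le[OF et_int has_integral_diff[OF ftc has_integral_mult_right[OF e_int]]])
        (use balance \<tau>' in auto)
    then show ?thesis using flux[OF \<tau>] by simp
  qed
  define F where "F \<tau> = exp (r * \<tau>) * I \<tau> - \<epsilon> * exp (r * t) * \<tau>" for \<tau>
  have "F t \<le> F s"
  proof (rule DERIV_nonpos_imp_nonincreasing[OF \<open>s \<le> t\<close>])
    fix \<tau> assume \<tau>: "s \<le> \<tau>" "\<tau> \<le> t"
    have "(F has_real_derivative
        exp (r * \<tau>) * r * I \<tau> + exp (r * \<tau>) * I' \<tau> - \<epsilon> * exp (r * t)) (at \<tau>)"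
      unfolding F_def using \<tau> st by (auto intro!: derivative_eq_intros I_deriv)
    moreover have "exp (r * \<tau>) * r * I \<tau> + exp (r * \<tau>) * I' \<tau> - \<epsilon> * exp (r * t) \<le> 0"
    proof -
      have "exp (r * \<tau>) * (r * I \<tau> + I' \<tau>) \<le> exp (r * \<tau>) * \<epsilon>"
        using I'_le[of \<tau>] \<tau> by (intro mult_left_mono) auto
      also have "\<dots> \<le> exp (r * t) * \<epsilon>"
        using \<tau> pos by (intro mult_right_mono) (auto intro: mult_left_mono)
      finally show ?thesis by (simp add: algebra_simps)
    qed
    ultimately show "\<exists>y. (F has_real_derivative y) (at \<tau>) \<and> y \<le> 0" by blast
  qed
  then show ?thesis unfolding F_def I_def by (simp add: algebra_simps)
qed

lemma integral_shrinking_interval_tendsto: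
  fixes f :: "real \<Rightarrow> real"
  assumes "0 < l" "continuous_on {0..l} f"
  shows "((\<lambda>d. integral {d..l - d} f) \<longlongrightarrow> integral {0..l} f) (at_right 0)"
proof -
  have int: "f integrable_on {0..l}" using assms by (simp add: integrable_continuous_real)
  define G where "G x = integral {0..x} f" for x
  have cG: "continuous_on {0..l} G" unfolding G_def by (rule indefinite_integral_continuous_1[OF int])
  have "continuous_on {0..l} (\<lambda>d. G (l - d) - G d)"
    by (intro continuous_intros continuous_on_compose2[OF cG] cG) auto
  then have "((\<lambda>d. G (l - d) - G d) \<longlongrightarrow> G l - G 0) (at 0 within {0..l})"
    using assms(1) by (auto simp: continuous_on_def dest: bspec[of _ _ 0])
  then have "((\<lambda>d. G (l - d) - G d) \<longlongrightarrow> G l - G 0) (at_right 0)"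
    using assms by (simp add: at_within_Icc_at_right)
  moreover have "eventually (\<lambda>d. d \<in> {0<..<l / 2}) (at_right 0)"
    using assms by (intro eventually_at_right_real) auto
  then have "eventually (\<lambda>d. G (l - d) - G d = integral {d..l - d} f) (at_right 0)"
  proof eventually_elim
    case (elim d)
    then have "integral {0..d} f + integral {d..l - d} f = integral {0..l - d} f"
      by (intro Henstock_Kurzweil_Integration.integral_combine integrable_on_subinterval[OF int]) auto
    then show ?case by (simp add: G_def)
  qed
  ultimately have "((\<lambda>d. integral {d..l - d} f) \<longlongrightarrow> G l - G 0) (at_right 0)"
    by (rule Lim_transform_eventually)
  then show ?thesis by (simp add: G_def)
qed

text \<open>The derivative \<open>et\<close> may blow up at \<open>x = 0\<close> and \<open>x = l\<close>, so differentiation under the integral is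
justified only on \<open>[d, l - d]\<close>. The integrated inequality involves just \<open>e\<close> and \<open>B\<close>, which are
continuous up to the ends, and therefore passes to the limit \<open>d \<rightarrow> 0\<close>.\<close>

lemma energy_decay_from_local_balance:
  fixes e et B Bx :: "real \<Rightarrow> real \<Rightarrow> real"
  assumes l: "0 < l" and st: "0 < s" "s \<le> t" "t < T" and r: "0 \<le> r"
    and cont_e: "\<And>\<tau>. \<tau> \<in> {0<..<T} \<Longrightarrow> continuous_on {0..l} (\<lambda>x. e x \<tau>)"
    and deriv_e: "\<And>x \<tau>. x \<in> {0<..<l} \<Longrightarrow> \<tau> \<in> {0<..<T} \<Longrightarrow>
      ((\<lambda>\<sigma>. e x \<sigma>) has_real_derivative et x \<tau>) (at \<tau>)"
    and cont_et: "continuous_on ({0<..<l} \<times> {0<..<T}) (\<lambda>(x, \<tau>). et x \<tau>)"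
    and cont_B: "continuous_on ({0..l} \<times> {0<..<T}) (\<lambda>(x, \<tau>). B x \<tau>)"
    and deriv_B: "\<And>x \<tau>. x \<in> {0<..<l} \<Longrightarrow> \<tau> \<in> {0<..<T} \<Longrightarrow>
      ((\<lambda>y. B y \<tau>) has_real_derivative Bx x \<tau>) (at x)"
    and balance: "\<And>x \<tau>. x \<in> {0<..<l} \<Longrightarrow> \<tau> \<in> {0<..<T} \<Longrightarrow> et x \<tau> \<le> Bx x \<tau> - r * e x \<tau>"
    and flux: "\<And>\<tau>. \<tau> \<in> {0<..<T} \<Longrightarrow> B l \<tau> \<le> B 0 \<tau>"
  shows "exp (r * t) * integral {0..l} (\<lambda>x. e x t) \<le> exp (r * s) * integral {0..l} (\<lambda>x. e x s)"
proof -
  have approx: "exp (r * t) * integral {0..l} (\<lambda>x. e x t)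
      \<le> exp (r * s) * integral {0..l} (\<lambda>x. e x s) + \<epsilon> * exp (r * t) * (t - s)"
    if \<epsilon>: "0 < \<epsilon>" for \<epsilon>
  proof -
    have "uniformly_continuous_on ({0..l} \<times> {s..t}) (\<lambda>(x, \<tau>). B x \<tau>)"
      using st by (intro compact_uniformly_continuous continuous_on_subset[OF cont_B])
        (auto intro: compact_Times)
    then obtain \<delta> where \<delta>: "0 < \<delta>" and unif: "\<And>p q. p \<in> {0..l} \<times> {s..t} \<Longrightarrow> q \<in> {0..l} \<times> {s..t} \<Longrightarrow>
        dist q p < \<delta> \<Longrightarrow> dist (case q of (x, \<tau>) \<Rightarrow> B x \<tau>) (case p of (x, \<tau>) \<Rightarrow> B x \<tau>) < \<epsilon> / 2"
      using \<epsilon> unfolding uniformly_continuous_on_def by (metis half_gt_zero)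
    have near: "\<bar>B y \<tau> - B x \<tau>\<bar> < \<epsilon> / 2"
      if "x \<in> {0..l}" "y \<in> {0..l}" "\<tau> \<in> {s..t}" "\<bar>y - x\<bar> < \<delta>" for x y \<tau>
      using unif[of "(x, \<tau>)" "(y, \<tau>)"] that by (simp add: dist_Pair_Pair dist_real_def)
    have "eventually (\<lambda>d. d \<in> {0<..<min \<delta> (l / 2)}) (at_right 0)"
      using l \<delta> by (intro eventually_at_right_real) auto
    then have ev: "eventually (\<lambda>d. exp (r * t) * integral {d..l - d} (\<lambda>x. e x t)
      \<le> exp (r * s) * integral {d..l - d} (\<lambda>x. e x s) + \<epsilon> * exp (r * t) * (t - s)) (at_right 0)"
    proof eventually_elim
      case (elim d)
      then have d: "0 < d" "d < \<delta>" "d < l / 2" by auto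
      show ?case
      proof (rule energy_bound_on_subinterval[where B = B and Bx = Bx and et = et and T = T])
        show "continuous_on {d..l - d} (\<lambda>x. e x \<tau>)" if "\<tau> \<in> {0<..<T}" for \<tau>
          using d by (intro continuous_on_subset[OF cont_e[OF that]]) auto
        show "continuous_on ({d..l - d} \<times> {0<..<T}) (\<lambda>(x, \<tau>). et x \<tau>)"
          using d by (intro continuous_on_subset[OF cont_et]) auto
        show "B (l - d) \<tau> - B d \<tau> \<le> \<epsilon>" if "\<tau> \<in> {s..t}" for \<tau>
        proof -
          have "\<bar>B (l - d) \<tau> - B l \<tau>\<bar> < \<epsilon> / 2" "\<bar>B d \<tau> - B 0 \<tau>\<bar> < \<epsilon> / 2"
            by (rule near; use d that in simp)+
          moreover have "B l \<tau> \<le> B 0 \<tau>" using st that by (intro flux) auto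
          ultimately show ?thesis by linarith
        qed
      qed (use d st r \<epsilon> in \<open>auto intro: deriv_e balance has_field_derivative_at_within[OF deriv_B]\<close>)
    qed
    show ?thesis
      using l st cont_e
      by (intro tendsto_le[OF _ _ _ ev] tendsto_intros integral_shrinking_interval_tendsto) auto
  qed
  show ?thesis
  proof (rule field_le_epsilon)
    fix \<eta> :: real assume "0 < \<eta>"
    \<comment> \<open>The factor \<open>t - s + 1\<close> keeps the denominator positive when \<open>s = t\<close>.\<close>
    define \<epsilon> where "\<epsilon> = \<eta> / (exp (r * t) * (t - s + 1))"
    have \<epsilon>: "0 < \<epsilon>" using \<open>0 < \<eta>\<close> st by (simp add: \<epsilon>_def)
    have "\<epsilon> * exp (r * t) * (t - s) \<le> \<epsilon> * exp (r * t) * (t - s + 1)"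
      using \<epsilon> by (intro mult_left_mono) auto
    also have "\<dots> = \<eta>" using st by (simp add: \<epsilon>_def)
    finally show "exp (r * t) * integral {0..l} (\<lambda>x. e x t)
        \<le> exp (r * s) * integral {0..l} (\<lambda>x. e x s) + \<eta>"
      using approx[OF \<epsilon>] by linarith
  qed
qed

section \<open>Almost everywhere nonnegativity and \<open>L\<^sup>2\<close>-continuity of the energy\<close>

text \<open>The set where \<open>g\<close> is negative is open, and a nonempty open set has positive measure.\<close>

lemma AE_nonneg_imp_nonneg_on_open:
  fixes g :: "'a::euclidean_space \<Rightarrow> real"
  assumes S: "open S" and g: "continuous_on S g"
    and ae: "AE p in lebesgue_on S. 0 \<le> g p" and p: "p \<in> S"
  shows "0 \<le> g p"
proof (rule ccontr)
  assume neg: "\<not> 0 \<le> g p"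
  define N where "N = S \<inter> g -` {..<0}"
  have "open N"
    unfolding N_def using g S by (rule continuous_open_preimage) simp
  have "AE p in lebesgue. p \<in> S \<longrightarrow> 0 \<le> g p"
    using ae S by (subst (asm) AE_restrict_space_iff) auto
  then have "AE p in lebesgue. p \<notin> N"
    by eventually_elim (auto simp: N_def)
  then have "negligible N"
    using \<open>open N\<close> by (simp add: negligible_iff_null_sets AE_iff_null_sets)
  then have "N = {}" using \<open>open N\<close> open_not_negligible by blast
  then show False using neg p by (auto simp: N_def)
qed

text \<open>Young's inequality in the form \<open>\<bar>a\<^sup>2 - b\<^sup>2\<bar> \<le> (1 + 1/\<eta>) (a - b)\<^sup>2 + \<eta> b\<^sup>2\<close> is integrated: first \<open>\<eta>\<close> is taken
small, then the \<open>L\<^sup>2\<close>-distance.\<close>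

lemma weighted_square_integral_tendsto:
  fixes f :: "'b \<Rightarrow> 'a \<Rightarrow> real" and g \<rho> :: "'a \<Rightarrow> real"
  assumes \<rho>_meas: "\<rho> \<in> borel_measurable M"
    and \<rho>_bd: "\<And>x. x \<in> space M \<Longrightarrow> 0 \<le> \<rho> x \<and> \<rho> x \<le> K"
    and f_meas: "\<And>s. s \<in> S \<Longrightarrow> f s \<in> borel_measurable M"
    and f_int: "\<And>s. s \<in> S \<Longrightarrow> integrable M (\<lambda>x. (f s x)\<^sup>2)"
    and g_meas: "g \<in> borel_measurable M" and g_int: "integrable M (\<lambda>x. (g x)\<^sup>2)"
    and S: "eventually (\<lambda>s. s \<in> S) F"
    and lim: "((\<lambda>s. \<integral>x. (f s x - g x)\<^sup>2 \<partial>M) \<longlongrightarrow> 0) F"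
  shows "((\<lambda>s. \<integral>x. \<rho> x * (f s x)\<^sup>2 \<partial>M) \<longlongrightarrow> (\<integral>x. \<rho> x * (g x)\<^sup>2 \<partial>M)) F"
proof -
  \<comment> \<open>The bound \<open>K\<close> may be \<open>0\<close>; a positive one can be divided by.\<close>
  define K' where "K' = max K 1"
  define J where "J = (\<integral>x. (g x)\<^sup>2 \<partial>M)"
  define I where "I s = (\<integral>x. (f s x - g x)\<^sup>2 \<partial>M)" for s
  have K': "0 < K'" "\<And>x. x \<in> space M \<Longrightarrow> \<rho> x \<le> K'"
    using \<rho>_bd unfolding K'_def by fastforce+
  have J: "0 \<le> J" by (simp add: J_def)
  have weighted_int: "integrable M (\<lambda>x. \<rho> x * (h x)\<^sup>2)"
    if "h \<in> borel_measurable M" "integrable M (\<lambda>x. (h x)\<^sup>2)" for h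
  proof (rule Bochner_Integration.integrable_bound)
    show "integrable M (\<lambda>x. K' * (h x)\<^sup>2)" using that(2) by (rule integrable_mult_right)
    show "AE x in M. norm (\<rho> x * (h x)\<^sup>2) \<le> norm (K' * (h x)\<^sup>2)"
      using \<rho>_bd K' by (auto simp: abs_mult intro!: mult_right_mono)
  qed (use \<rho>_meas that in measurable)
  have bound: "\<bar>(\<integral>x. \<rho> x * (f s x)\<^sup>2 \<partial>M) - (\<integral>x. \<rho> x * (g x)\<^sup>2 \<partial>M)\<bar> \<le> K' * ((1 + 1 / \<eta>) * I s + \<eta> * J)"
    if s: "s \<in> S" and \<eta>: "0 < \<eta>" for s \<eta>
  proof -
    note [measurable] = f_meas[OF s] g_meas \<rho>_meas
    have diff_int: "integrable M (\<lambda>x. (f s x - g x)\<^sup>2)"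
    proof (rule Bochner_Integration.integrable_bound)
      show "integrable M (\<lambda>x. 2 * (f s x)\<^sup>2 + 2 * (g x)\<^sup>2)"
        using f_int[OF s] g_int by simp
      have "(a - b)\<^sup>2 \<le> 2 * a\<^sup>2 + 2 * b\<^sup>2" for a b :: real
        using zero_le_power2[of "a + b"] by (simp add: power2_eq_square algebra_simps)
      then show "AE x in M. norm ((f s x - g x)\<^sup>2) \<le> norm (2 * (f s x)\<^sup>2 + 2 * (g x)\<^sup>2)"
        by (simp add: abs_of_nonneg)
    qed measurable
    have young: "\<bar>a\<^sup>2 - b\<^sup>2\<bar> \<le> (1 + 1 / \<eta>) * (a - b)\<^sup>2 + \<eta> * b\<^sup>2" for a b :: real
    proof -
      have "0 \<le> (\<eta> * b - (a - b))\<^sup>2 / \<eta>" "0 \<le> (\<eta> * b + (a - b))\<^sup>2 / \<eta>" using \<eta> by auto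
      moreover have "(\<eta> * b - (a - b))\<^sup>2 / \<eta> = \<eta> * b\<^sup>2 - 2 * b * (a - b) + (a - b)\<^sup>2 / \<eta>"
        "(\<eta> * b + (a - b))\<^sup>2 / \<eta> = \<eta> * b\<^sup>2 + 2 * b * (a - b) + (a - b)\<^sup>2 / \<eta>"
        using \<eta> by (simp_all add: field_simps power2_eq_square)
      moreover have "a\<^sup>2 - b\<^sup>2 = (a - b)\<^sup>2 + 2 * b * (a - b)"
        by (simp add: power2_eq_square algebra_simps)
      moreover have "(1 + 1 / \<eta>) * (a - b)\<^sup>2 = (a - b)\<^sup>2 + (a - b)\<^sup>2 / \<eta>"
        by (simp add: algebra_simps)
      ultimately show ?thesis
        using zero_le_power2[of "a - b"] by linarith
    qed
    have "\<bar>(\<integral>x. \<rho> x * (f s x)\<^sup>2 \<partial>M) - (\<integral>x. \<rho> x * (g x)\<^sup>2 \<partial>M)\<bar>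
        = \<bar>\<integral>x. \<rho> x * (f s x)\<^sup>2 - \<rho> x * (g x)\<^sup>2 \<partial>M\<bar>"
      by (subst Bochner_Integration.integral_diff)
        (auto intro!: weighted_int f_meas g_meas f_int g_int s)
    also have "\<dots> \<le> (\<integral>x. \<bar>\<rho> x * (f s x)\<^sup>2 - \<rho> x * (g x)\<^sup>2\<bar> \<partial>M)"
      by (rule integral_abs_bound)
    also have "\<dots> \<le> (\<integral>x. K' * ((1 + 1 / \<eta>) * (f s x - g x)\<^sup>2 + \<eta> * (g x)\<^sup>2) \<partial>M)"
    proof (rule integral_mono)
      show "integrable M (\<lambda>x. \<bar>\<rho> x * (f s x)\<^sup>2 - \<rho> x * (g x)\<^sup>2\<bar>)"
        by (intro integrable_abs Bochner_Integration.integrable_diff weighted_int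
            f_meas g_meas f_int g_int s)
      show "integrable M (\<lambda>x. K' * ((1 + 1 / \<eta>) * (f s x - g x)\<^sup>2 + \<eta> * (g x)\<^sup>2))"
        by (intro integrable_mult_right Bochner_Integration.integrable_add diff_int g_int)
      fix x assume x: "x \<in> space M"
      have "\<bar>\<rho> x * (f s x)\<^sup>2 - \<rho> x * (g x)\<^sup>2\<bar> = \<rho> x * \<bar>(f s x)\<^sup>2 - (g x)\<^sup>2\<bar>"
        using \<rho>_bd[OF x] by (simp add: right_diff_distrib[symmetric] abs_mult)
      also have "\<dots> \<le> K' * ((1 + 1 / \<eta>) * (f s x - g x)\<^sup>2 + \<eta> * (g x)\<^sup>2)"
        using K' x by (intro mult_mono young) auto
      finally show "\<bar>\<rho> x * (f s x)\<^sup>2 - \<rho> x * (g x)\<^sup>2\<bar>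
          \<le> K' * ((1 + 1 / \<eta>) * (f s x - g x)\<^sup>2 + \<eta> * (g x)\<^sup>2)" .
    qed
    also have "\<dots> = K' * ((1 + 1 / \<eta>) * I s + \<eta> * J)"
      unfolding I_def J_def using diff_int g_int by simp
    finally show ?thesis .
  qed
  show ?thesis
  proof (rule tendstoI)
    fix \<epsilon> :: real assume "0 < \<epsilon>"
    define \<eta> where "\<eta> = \<epsilon> / (2 * K' * (J + 1))"
    have \<eta>: "0 < \<eta>" using \<open>0 < \<epsilon>\<close> K' J by (simp add: \<eta>_def)
    have small: "K' * (\<eta> * J) < \<epsilon> / 2"
    proof -
      have "K' * (\<eta> * J) < K' * (\<eta> * (J + 1))"
        using K' \<eta> by simp
      also have "\<dots> = \<epsilon> / 2" using K' J by (simp add: \<eta>_def)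
      finally show ?thesis .
    qed
    have "((\<lambda>s. K' * ((1 + 1 / \<eta>) * I s)) \<longlongrightarrow> K' * ((1 + 1 / \<eta>) * 0)) F"
      using lim unfolding I_def by (intro tendsto_intros)
    then have "eventually (\<lambda>s. K' * ((1 + 1 / \<eta>) * I s) < \<epsilon> / 2) F"
      using \<open>0 < \<epsilon>\<close> by (intro order_tendstoD) auto
    with S show "eventually (\<lambda>s. dist (\<integral>x. \<rho> x * (f s x)\<^sup>2 \<partial>M) (\<integral>x. \<rho> x * (g x)\<^sup>2 \<partial>M) < \<epsilon>) F"
    proof eventually_elim
      case (elim s)
      then show ?case
        using bound[OF elim(1) \<eta>] small unfolding dist_real_def distrib_left by linarith
    qed
  qed
qed

section \<open>The weight and the reaction term\<close>

lemma weight_pos: "0 < rho0 \<Longrightarrow> 0 < weight rho0 v Dax x"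
  by (simp add: weight_def)

lemma weight_le:
  assumes "0 < rho0" "0 < v" "0 < Dax" "0 \<le> x"
  shows "weight rho0 v Dax x \<le> rho0"
  using assms by (simp add: weight_def mult_le_cancel_left1)

lemma weight_has_derivative:
  "(weight rho0 v Dax has_real_derivative - (v / (2 * Dax)) * weight rho0 v Dax x) (at x within A)"
  unfolding weight_def[abs_def] by (rule derivative_eq_intros refl)+ simp

lemma continuous_on_weight [continuous_intros]:
  "continuous_on A f \<Longrightarrow> continuous_on A (\<lambda>x. weight rho0 v Dax (f x))"
  unfolding weight_def[abs_def] by (intro continuous_intros)

text \<open>The factors \<open>y\<close> and \<open>(y + c)\<^sup>n - c\<^sup>n\<close> have the same sign, by monotonicity of the power.\<close>

lemma reaction_dissipative:
  fixes c y n :: real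
  assumes "0 \<le> n" "0 \<le> c" "0 \<le> y + c"
  shows "0 \<le> y * ((y + c) powr n - c powr n)"
proof (cases "0 \<le> y")
  case True
  then show ?thesis using assms powr_mono2[of n c "y + c"] by simp
next
  case False
  then show ?thesis using assms powr_mono2[of n "y + c" c] by (simp add: mult_nonpos_nonpos)
qed

section \<open>Decay of the weighted energy of a solution\<close>

context
  fixes l Dax v k n alpha rho0 T :: real and C :: "real \<Rightarrow> real"
    and u :: "real \<Rightarrow> real" and w :: "real \<Rightarrow> real \<Rightarrow> real"
  assumes pos: "0 < l" "0 < Dax" "0 < v" "0 < k" "0 < n" "0 < rho0" "0 < T"
    and alpha: "alpha \<le> 1 / 2"
    and cont_C: "continuous_on {0..l} C" and C_nonneg: "\<And>x. x \<in> {0..l} \<Longrightarrow> 0 \<le> C x"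
    and sol: "deviation_solution Dax v k n l T C u w"
    and nonneg: "nonneg_concentration l T C w"
    and feedback: "\<And>t. t \<in> {0<..<T} \<Longrightarrow> u t = alpha * w 0 t"
begin

lemma concentration_nonneg:
  assumes "continuous_on ({0..l} \<times> {0<..<T}) (\<lambda>(x, t). w x t)"
    and "x \<in> {0<..<l}" "t \<in> {0<..<T}"
  shows "0 \<le> w x t + C x"
proof -
  let ?R = "{0<..<l} \<times> {0<..<T}"
  have "open ?R" by (intro open_Times) auto
  moreover have "continuous_on ?R (\<lambda>p. (case p of (x, t) \<Rightarrow> w x t) + C (fst p))"
    by (intro continuous_intros continuous_on_subset[OF assms(1)]
        continuous_on_compose2[OF cont_C]) auto
  moreover have "AE p in lebesgue_on ?R. 0 \<le> (case p of (x, t) \<Rightarrow> w x t) + C (fst p)"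
    using nonneg unfolding nonneg_concentration_def by (simp add: case_prod_unfold)
  moreover have "(x, t) \<in> ?R" using assms by simp
  ultimately have "0 \<le> (case (x, t) of (x, t) \<Rightarrow> w x t) + C (fst (x, t))"
    by (rule AE_nonneg_imp_nonneg_on_open)
  then show ?thesis by simp
qed

text \<open>This is where the equation, the boundary conditions and the feedback law enter. The flux
\<open>B = 2 \<rho> (Dax w w\<^sub>x - (v / 4) w\<^sup>2)\<close> splits the convection term \<open>- 2 v \<rho> w w\<^sub>x\<close> into two halves: one is
absorbed by the derivative of the weight in \<open>2 (\<rho> Dax w w\<^sub>x)\<^sub>x\<close>, the other is \<open>- \<rho> (v / 2) (w\<^sup>2)\<^sub>x\<close>, and
moving its derivative to the weight produces the damping.\<close>

lemma weighted_energy_decay_interior: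
  assumes st: "0 < s" "s \<le> t" "t < T"
  shows "exp (v\<^sup>2 / (4 * Dax) * t) * (\<integral>x. weight rho0 v Dax x * (w x t)\<^sup>2 \<partial>lebesgue_on {0<..<l})
    \<le> exp (v\<^sup>2 / (4 * Dax) * s) * (\<integral>x. weight rho0 v Dax x * (w x s)\<^sup>2 \<partial>lebesgue_on {0<..<l})"
proof -
  let ?\<rho> = "weight rho0 v Dax"
  from sol obtain wt wx wxx where
    w_x: "\<forall>x\<in>{0..l}. \<forall>t\<in>{0<..<T}.
      ((\<lambda>y. w y t) has_real_derivative wx x t) (at x within {0..l})"
    and w_xx_t: "\<forall>x\<in>{0<..<l}. \<forall>t\<in>{0<..<T}.
      ((\<lambda>y. wx y t) has_real_derivative wxx x t) (at x) \<and>
      ((\<lambda>s. w x s) has_real_derivative wt x t) (at t)"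
    and cont_w: "continuous_on ({0..l} \<times> {0<..<T}) (\<lambda>(x, t). w x t)"
    and cont_wx: "continuous_on ({0..l} \<times> {0<..<T}) (\<lambda>(x, t). wx x t)"
    and cont_wt: "continuous_on ({0<..<l} \<times> {0<..<T}) (\<lambda>(x, t). wt x t)"
    and pde: "\<forall>x\<in>{0<..<l}. \<forall>t\<in>{0<..<T}.
      wt x t = Dax * wxx x t - v * wx x t + k * C x powr n - k * (w x t + C x) powr n"
    and bc: "\<forall>t\<in>{0<..<T}. w 0 t = u t + Dax / v * wx 0 t \<and> wx l t = 0"
    unfolding deviation_solution_def by (elim conjE exE) (rule that)
  note w_x = w_x[rule_format] and w_xx = w_xx_t[rule_format, THEN conjunct1]
    and w_t = w_xx_t[rule_format, THEN conjunct2] and pde = pde[rule_format] and bc = bc[rule_format]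
  define e where "e x t = ?\<rho> x * (w x t)\<^sup>2" for x t
  define et where "et x t = ?\<rho> x * (2 * w x t * wt x t)" for x t
  define B where "B x t = 2 * ?\<rho> x * (Dax * w x t * wx x t - v / 4 * (w x t)\<^sup>2)" for x t
  define Bx where "Bx x t = 2 * ?\<rho> x * (Dax * w x t * wxx x t - v * w x t * wx x t
      + Dax * (wx x t)\<^sup>2 + v\<^sup>2 / (8 * Dax) * (w x t)\<^sup>2)" for x t
  have cont_e: "continuous_on {0..l} (\<lambda>x. e x \<tau>)" if "\<tau> \<in> {0<..<T}" for \<tau>
  proof -
    have "continuous_on {0..l} (\<lambda>x. w x \<tau>)"
      by (rule DERIV_continuous_on[OF w_x[OF _ that]])
    then show ?thesis unfolding e_def by (intro continuous_intros)
  qed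
  have energy_eq: "(\<integral>x. ?\<rho> x * (w x \<tau>)\<^sup>2 \<partial>lebesgue_on {0<..<l}) = integral {0..l} (\<lambda>x. e x \<tau>)"
    if \<tau>: "\<tau> \<in> {0<..<T}" for \<tau>
  proof -
    have "integrable (lebesgue_on {0<..<l}) (\<lambda>x. e x \<tau>)"
    proof (rule absolutely_integrable_imp_integrable)
      show "(\<lambda>x. e x \<tau>) absolutely_integrable_on {0<..<l}"
        by (rule set_integrable_subset[OF absolutely_integrable_continuous_real[OF cont_e[OF \<tau>]]])
          auto
    qed simp
    then have "integral\<^sup>L (lebesgue_on {0<..<l}) (\<lambda>x. e x \<tau>) = integral {0<..<l} (\<lambda>x. e x \<tau>)"
      by (rule lebesgue_integral_eq_integral) simp
    then show ?thesis by (simp add: e_def integral_open_interval_real)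
  qed
  have "exp (v\<^sup>2 / (4 * Dax) * t) * integral {0..l} (\<lambda>x. e x t)
      \<le> exp (v\<^sup>2 / (4 * Dax) * s) * integral {0..l} (\<lambda>x. e x s)"
  proof (rule energy_decay_from_local_balance[where et = et and B = B and Bx = Bx and T = T])
    show "((\<lambda>\<sigma>. e x \<sigma>) has_real_derivative et x \<tau>) (at \<tau>)"
      if "x \<in> {0<..<l}" "\<tau> \<in> {0<..<T}" for x \<tau>
      unfolding e_def et_def by (rule derivative_eq_intros w_t[OF that] refl)+ simp
    have "continuous_on ({0<..<l} \<times> {0<..<T})
        (\<lambda>p. ?\<rho> (fst p) * (2 * (case p of (x, t) \<Rightarrow> w x t) * (case p of (x, t) \<Rightarrow> wt x t)))"
      by (intro continuous_intros continuous_on_subset[OF cont_w] cont_wt) auto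
    then show "continuous_on ({0<..<l} \<times> {0<..<T}) (\<lambda>(x, \<tau>). et x \<tau>)"
      unfolding et_def by (simp add: case_prod_unfold)
    have "continuous_on ({0..l} \<times> {0<..<T}) (\<lambda>p. 2 * ?\<rho> (fst p) *
        (Dax * (case p of (x, t) \<Rightarrow> w x t) * (case p of (x, t) \<Rightarrow> wx x t)
          - v / 4 * (case p of (x, t) \<Rightarrow> w x t)\<^sup>2))"
      by (intro continuous_intros cont_w cont_wx)
    then show "continuous_on ({0..l} \<times> {0<..<T}) (\<lambda>(x, \<tau>). B x \<tau>)"
      unfolding B_def by (simp add: case_prod_unfold)
    show "((\<lambda>y. B y \<tau>) has_real_derivative Bx x \<tau>) (at x)"
      if x: "x \<in> {0<..<l}" and \<tau>: "\<tau> \<in> {0<..<T}" for x \<tau>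
    proof -
      have w_x': "((\<lambda>y. w y \<tau>) has_real_derivative wx x \<tau>) (at x)"
      proof -
        have "at x within {0..l} = at x" using x by (intro at_within_interior) simp
        then show ?thesis using w_x[of x \<tau>] x \<tau> by simp
      qed
      \<comment> \<open>Without the factor \<open>2 \<rho>\<close>, the flux and its derivative are \<open>?P\<close> and \<open>?P'\<close>.\<close>
      let ?P = "Dax * (w x \<tau> * wx x \<tau>) - v / 4 * (w x \<tau>)\<^sup>2"
      let ?P' = "Dax * (wx x \<tau> * wx x \<tau> + wxx x \<tau> * w x \<tau>) - v / 4 * (2 * (w x \<tau> * wx x \<tau>))"
      have "((\<lambda>y. (w y \<tau>)\<^sup>2) has_real_derivative 2 * (w x \<tau> * wx x \<tau>)) (at x)"
        using DERIV_power[OF w_x', of 2] by (simp add: mult_ac)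
      then have "((\<lambda>y. Dax * (w y \<tau> * wx y \<tau>) - v / 4 * (w y \<tau>)\<^sup>2) has_real_derivative ?P') (at x)"
        by (intro DERIV_diff DERIV_cmult DERIV_mult w_x' w_xx[OF x \<tau>])
      from DERIV_cmult[OF DERIV_mult[OF weight_has_derivative this], of 2]
      have "((\<lambda>y. B y \<tau>) has_real_derivative
          2 * (- (v / (2 * Dax)) * ?\<rho> x * ?P + ?P' * ?\<rho> x)) (at x)"
        by (simp add: B_def mult.assoc)
      moreover have "2 * (- (v / (2 * Dax)) * ?\<rho> x * ?P + ?P' * ?\<rho> x) = Bx x \<tau>"
        using pos by (simp add: Bx_def field_simps power2_eq_square)
      ultimately show ?thesis by simp
    qed
    show "et x \<tau> \<le> Bx x \<tau> - v\<^sup>2 / (4 * Dax) * e x \<tau>"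
      if x: "x \<in> {0<..<l}" and \<tau>: "\<tau> \<in> {0<..<T}" for x \<tau>
    proof -
      have "0 \<le> w x \<tau> * ((w x \<tau> + C x) powr n - C x powr n)"
        using x \<tau> pos by (intro reaction_dissipative C_nonneg concentration_nonneg[OF cont_w]) auto
      then have "0 \<le> k * (w x \<tau> * ((w x \<tau> + C x) powr n - C x powr n)) + Dax * (wx x \<tau>)\<^sup>2"
        using pos by simp
      then have "0 \<le> 2 * ?\<rho> x * (k * (w x \<tau> * ((w x \<tau> + C x) powr n - C x powr n))
          + Dax * (wx x \<tau>)\<^sup>2)"
        using weight_pos[OF \<open>0 < rho0\<close>, of v Dax x] by (intro mult_nonneg_nonneg) simp_all
      also have "\<dots> = Bx x \<tau> - v\<^sup>2 / (4 * Dax) * e x \<tau> - et x \<tau>"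
        unfolding Bx_def e_def et_def pde[OF x \<tau>] using pos by (simp add: field_simps power2_eq_square)
      finally show ?thesis by simp
    qed
    show "B l \<tau> \<le> B 0 \<tau>" if \<tau>: "\<tau> \<in> {0<..<T}" for \<tau>
    proof -
      have "Dax * wx 0 \<tau> = v * (1 - alpha) * w 0 \<tau>"
        using bc[OF \<tau>] feedback[OF \<tau>] pos by (simp add: field_simps)
      then have "Dax * w 0 \<tau> * wx 0 \<tau> = v * (1 - alpha) * (w 0 \<tau>)\<^sup>2"
        by (simp add: power2_eq_square)
      then have "B 0 \<tau> = 2 * ?\<rho> 0 * (v * (3 / 4 - alpha) * (w 0 \<tau>)\<^sup>2)"
        unfolding B_def by (simp only:) (simp add: algebra_simps)
      then have "0 \<le> B 0 \<tau>"
        using weight_pos[OF \<open>0 < rho0\<close>, of v Dax 0] pos alpha by simp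
      moreover have "B l \<tau> \<le> 0"
        using weight_pos[OF \<open>0 < rho0\<close>, of v Dax l] pos bc[OF \<tau>]
        by (simp add: B_def mult_nonneg_nonpos)
      ultimately show ?thesis by simp
    qed
  qed (use pos st cont_e in auto)
  then show ?thesis using st by (simp add: energy_eq)
qed

lemma weighted_energy_tendsto:
  assumes t: "t \<in> {0..T}"
  shows "((\<lambda>s. \<integral>x. weight rho0 v Dax x * (w x s)\<^sup>2 \<partial>lebesgue_on {0<..<l})
    \<longlongrightarrow> (\<integral>x. weight rho0 v Dax x * (w x t)\<^sup>2 \<partial>lebesgue_on {0<..<l})) (at t within {0..T})"
proof (rule weighted_square_integral_tendsto[where S = "{0..T}" and K = rho0])
  show "weight rho0 v Dax \<in> borel_measurable (lebesgue_on {0<..<l})"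
    by (intro continuous_imp_measurable_on_sets_lebesgue continuous_intros) auto
  show "eventually (\<lambda>s. s \<in> {0..T}) (at t within {0..T})"
    by (simp add: eventually_at_filter)
  show "0 \<le> weight rho0 v Dax x \<and> weight rho0 v Dax x \<le> rho0"
    if "x \<in> space (lebesgue_on {0<..<l})" for x
    using that pos weight_pos[of rho0 v Dax x] weight_le[of rho0 v Dax x] by auto
qed (use sol t in \<open>auto simp: deviation_solution_def in_L2_def\<close>)

text \<open>For \<open>0 < s < t < T\<close> the weighted energy times the exponential is nonincreasing; continuity in \<open>L\<^sup>2\<close> lets
first \<open>s \<rightarrow> 0\<close> and then \<open>t \<rightarrow> T\<close>.\<close>

lemma weighted_energy_decay:
  assumes t: "t \<in> {0..T}"
  shows "exp (v\<^sup>2 / (4 * Dax) * t) * (\<integral>x. weight rho0 v Dax x * (w x t)\<^sup>2 \<partial>lebesgue_on {0<..<l})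
    \<le> (\<integral>x. weight rho0 v Dax x * (w x 0)\<^sup>2 \<partial>lebesgue_on {0<..<l})"
proof -
  define F where "F s = exp (v\<^sup>2 / (4 * Dax) * s) *
    (\<integral>x. weight rho0 v Dax x * (w x s)\<^sup>2 \<partial>lebesgue_on {0<..<l})" for s
  have F_lim: "(F \<longlongrightarrow> F s) (at s within {0..T})" if "s \<in> {0..T}" for s
    unfolding F_def using weighted_energy_tendsto[OF that] by (intro tendsto_intros)
  have interior: "F s \<le> F 0" if s: "0 < s" "s < T" for s
  proof (rule tendsto_lowerbound)
    show "(F \<longlongrightarrow> F 0) (at_right 0)"
      using F_lim[of 0] pos by (simp add: at_within_Icc_at_right)
    have "eventually (\<lambda>r. r \<in> {0<..<s}) (at_right 0)" using s by (intro eventually_at_right_real) simp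
    then show "eventually (\<lambda>r. F s \<le> F r) (at_right 0)"
      by eventually_elim (use s weighted_energy_decay_interior in \<open>auto simp: F_def\<close>)
  qed simp
  consider "t = 0" | "0 < t" "t < T" | "t = T" using t by fastforce
  then have "F t \<le> F 0"
  proof cases
    case 3
    have "F T \<le> F 0"
    proof (rule tendsto_upperbound)
      show "(F \<longlongrightarrow> F T) (at_left T)"
        using F_lim[of T] pos by (simp add: at_within_Icc_at_left)
      have "eventually (\<lambda>s. s \<in> {0<..<T}) (at_left T)" using pos by (intro eventually_at_left_real)
      then show "eventually (\<lambda>s. F s \<le> F 0) (at_left T)"
        by eventually_elim (auto intro: interior)
    qed simp
    then show ?thesis using 3 by simp
  qed (use interior in auto)
  then show ?thesis by (simp add: F_def)
qed

lemma weighted_norm_decay: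
  assumes t: "t \<in> {0..T}"
  shows "weighted_norm (weight rho0 v Dax) l (\<lambda>x. w x t)
    \<le> exp (- (v\<^sup>2 / (8 * Dax)) * t) * weighted_norm (weight rho0 v Dax) l (\<lambda>x. w x 0)"
proof -
  define Q where "Q s = (\<integral>x. weight rho0 v Dax x * (w x s)\<^sup>2 \<partial>lebesgue_on {0<..<l})" for s
  define q where "q = v\<^sup>2 / (8 * Dax) * t"
  have "v\<^sup>2 / (4 * Dax) * t = 2 * q" by (simp add: q_def)
  then have "exp (2 * q) * Q t \<le> Q 0"
    using weighted_energy_decay[OF t] unfolding Q_def by (simp only:)
  then have "sqrt ((exp q)\<^sup>2 * Q t) \<le> sqrt (Q 0)"
    by (simp add: exp_double[symmetric])
  then have "exp q * sqrt (Q t) \<le> sqrt (Q 0)"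
    by (simp add: real_sqrt_mult)
  then have "sqrt (Q t) \<le> exp (- q) * sqrt (Q 0)"
    by (simp add: exp_minus field_simps)
  then show ?thesis by (simp add: weighted_norm_def Q_def q_def)
qed

end

section \<open>Decay rate\<close>

lemma weighted_norm_nonneg: "(\<And>x. 0 \<le> \<rho> x) \<Longrightarrow> 0 \<le> weighted_norm \<rho> l f"
  by (simp add: weighted_norm_def)

text \<open>If the norm vanishes at time \<open>t\<close>, or at time \<open>0\<close> (where division by zero gives the ratio \<open>0\<close>), the
extended logarithm is \<open>-\<infinity>\<close>, which only helps the upper bound on the limit superior.\<close>

lemma decay_rate_ge:
  assumes \<rho>: "\<And>x. 0 \<le> \<rho> x"
    and decay: "\<And>t. 0 < t \<Longrightarrow> weighted_norm \<rho> l (\<lambda>x. w x t)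
    \<le> exp (- r * t) * weighted_norm \<rho> l (\<lambda>x. w x 0)"
  shows "ereal r \<le> decay_rate \<rho> l w"
proof -
  define N where "N t = weighted_norm \<rho> l (\<lambda>x. w x t)" for t
  have bound: "ereal (1 / t) * ext_log (N t / N 0) \<le> ereal (- r)" if t: "0 < t" for t
  proof (cases "N t / N 0 > 0")
    case True
    have le: "N t \<le> exp (- r * t) * N 0" using decay[OF t] by (simp add: N_def)
    have "0 \<le> N 0" unfolding N_def by (rule weighted_norm_nonneg[OF \<rho>])
    then have "0 < N 0" using True by (auto simp: less_le)
    then have "N t / N 0 \<le> exp (- r * t)" using le by (simp add: field_simps)
    then have "ln (N t / N 0) \<le> - r * t" using True by (metis exp_gt_zero ln_exp ln_le_cancel_iff)
    then show ?thesis using True t by (simp add: ext_log_def field_simps)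
  next
    case False
    then show ?thesis using t by (auto simp: ext_log_def)
  qed
  have "Limsup at_top (\<lambda>t. ereal (1 / t) * ext_log (N t / N 0)) \<le> ereal (- r)"
    by (intro Limsup_bounded eventually_mono[OF eventually_gt_at_top[of 0]] bound)
  then show ?thesis
    unfolding decay_rate_def N_def using ereal_minus_le_minus by fastforce
qed

theorem mainTheorem3:
  fixes l Dax v k n alpha rho0 ubar :: real and C :: "real \<Rightarrow> real"
  assumes "l > 0" and "Dax > 0" and "v > 0" and "k > 0" and "n > 0"
    and "0 \<le> alpha" and "alpha \<le> 1 / 2"
    and "rho0 > 0"
    and "ubar > 0"
    and "steady_state Dax v k n l ubar C"
    and "\<forall>x\<in>{0..l}. 0 \<le> C x"
  shows
    "(\<forall>T u w. T > 0 \<longrightarrow>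
        deviation_solution Dax v k n l T C u w \<longrightarrow>
        nonneg_concentration l T C w \<longrightarrow>
        (\<forall>t\<in>{0<..<T}. u t = alpha * w 0 t) \<longrightarrow>
        (\<forall>t\<in>{0..T}.
           weighted_norm (weight rho0 v Dax) l (\<lambda>x. w x t)
             \<le> exp (- (v\<^sup>2 / (16 * Dax)) * t) * weighted_norm (weight rho0 v Dax) l (\<lambda>x. w x 0)))
     \<and>
     (\<forall>u w.
        (\<forall>T>0. deviation_solution Dax v k n l T C u w) \<longrightarrow>
        (\<forall>T>0. nonneg_concentration l T C w) \<longrightarrow>
        (\<forall>t>0. u t = alpha * w 0 t) \<longrightarrow>
        \<not> (AE x in lebesgue_on {0<..<l}. w x 0 = 0) \<longrightarrow>
        decay_rate (weight rho0 v Dax) l w \<ge> ereal (lambda_T v Dax))"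
proof -
  have cont_C: "continuous_on {0..l} C"
    using \<open>steady_state Dax v k n l ubar C\<close> unfolding steady_state_def
    by (metis DERIV_continuous continuous_on_eq_continuous_within)
  have decay: "weighted_norm (weight rho0 v Dax) l (\<lambda>x. w x t)
      \<le> exp (- (v\<^sup>2 / (16 * Dax)) * t) * weighted_norm (weight rho0 v Dax) l (\<lambda>x. w x 0)"
    if "T > 0" "deviation_solution Dax v k n l T C u w" "nonneg_concentration l T C w"
      "\<And>t. t \<in> {0<..<T} \<Longrightarrow> u t = alpha * w 0 t" and t: "t \<in> {0..T}" for T u w t
  proof -
    have "weighted_norm (weight rho0 v Dax) l (\<lambda>x. w x t)
        \<le> exp (- (v\<^sup>2 / (8 * Dax)) * t) * weighted_norm (weight rho0 v Dax) l (\<lambda>x. w x 0)"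
      by (rule weighted_norm_decay[where T = T and C = C and u = u and alpha = alpha and k = k and n = n])
        (use assms that cont_C in auto)
    also have "\<dots> \<le> exp (- (v\<^sup>2 / (16 * Dax)) * t) * weighted_norm (weight rho0 v Dax) l (\<lambda>x. w x 0)"
    proof (rule mult_right_mono)
      have "v\<^sup>2 / (16 * Dax) * t \<le> v\<^sup>2 / (8 * Dax) * t"
        using \<open>Dax > 0\<close> t by (intro mult_right_mono) (auto simp: field_simps)
      then show "exp (- (v\<^sup>2 / (8 * Dax)) * t) \<le> exp (- (v\<^sup>2 / (16 * Dax)) * t)" by simp
      show "0 \<le> weighted_norm (weight rho0 v Dax) l (\<lambda>x. w x 0)"
        using weight_pos[OF \<open>rho0 > 0\<close>] by (intro weighted_norm_nonneg less_imp_le)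
    qed
    finally show ?thesis .
  qed
  show ?thesis
  proof (intro conjI allI impI ballI)
    fix u w
    assume sol: "\<forall>T>0. deviation_solution Dax v k n l T C u w"
      and nonneg: "\<forall>T>0. nonneg_concentration l T C w"
      and feedback: "\<forall>t>0. u t = alpha * w 0 t"
    show "ereal (lambda_T v Dax) \<le> decay_rate (weight rho0 v Dax) l w"
      unfolding lambda_T_def
    proof (rule decay_rate_ge)
      show "0 \<le> weight rho0 v Dax x" for x
        using weight_pos[OF \<open>rho0 > 0\<close>] by (rule less_imp_le)
      fix t :: real assume "0 < t"
      then show "weighted_norm (weight rho0 v Dax) l (\<lambda>x. w x t)
          \<le> exp (- (v\<^sup>2 / (16 * Dax)) * t) * weighted_norm (weight rho0 v Dax) l (\<lambda>x. w x 0)"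
        by (intro decay[where T = t and u = u]) (use sol nonneg feedback in auto)
    qed
  qed (use decay in blast)
qed

end
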